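(* There exist no three positive integers which are consecutive terms of an arithmetic progression and whose sum of squares is a perfect square. Equivalently, if $a_1, a_2, a_3$ are positive integers which are consecutive terms of an arithmetic progression, then there is no integer $t$ with $a_1^2 + a_2^2 + a_3^2 = t^2$.
   Context: Integers $a_1, a_2, a_3$ are consecutive terms of an arithmetic progression if there is an integer $d$ (the common difference) such that $a_2 = a_1 + d$ and $a_3 = a_1 + 2d$; increasing, decreasing and constant progressions are all allowed. A perfect square (integer square) is the square of an integer. *)

theory Defs
  imports "HOL-Computational_Algebra.Nth_Powers"
begin

(* The common difference may be negative or zero. *)
definition consecutive_in_AP :: "int \<Rightarrow> int \<Rightarrow> int \<Rightarrow> bool" where
  "consecutive_in_AP a1 a2 a3 \<longleftrightarrow> (\<exists>d::int. a2 = a1 + d \<and> a3 = a1 + 2 * d)"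

end

theory Submission
  imports Defs
begin

text \<open>
  Three consecutive terms with middle term \<open>x\<close> and common difference \<open>d\<close> have sum of squares
  \<open>(x - d)\<^sup>2 + x\<^sup>2 + (x + d)\<^sup>2 = 3 x\<^sup>2 + 2 d\<^sup>2\<close>. The quadratic form \<open>3 x\<^sup>2 + 2 d\<^sup>2 - t\<^sup>2\<close> is
  anisotropic at the prime 3: modulo 3, a zero satisfies \<open>t\<^sup>2 + d\<^sup>2 \<equiv> 0\<close>, which forces 3 to divide
  \<open>t\<close> and \<open>d\<close> because \<open>-1\<close> is not a square modulo 3; then 9 divides \<open>3 x\<^sup>2\<close>, so 3 divides \<open>x\<close>
  as well. Every zero can therefore be divided by 3, and infinite descent leaves only \<open>x = 0\<close>,
  whereas a progression of positive integers has \<open>x > 0\<close>.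
\<close>

text \<open>
  Squares are 0 or 1 modulo 3, so a sum of two of them vanishes only when both summands do.
\<close>

lemma three_dvd_sum_two_squares:
  fixes a b :: int
  assumes "3 dvd a\<^sup>2 + b\<^sup>2"
  shows "3 dvd a \<and> 3 dvd b"
proof -
  have sq: "n\<^sup>2 mod 3 = (if 3 dvd n then 0 else 1)" for n :: int
  proof -
    have "n mod 3 = 0 \<or> n mod 3 = 1 \<or> n mod 3 = 2" by presburger
    moreover have "n\<^sup>2 mod 3 = (n mod 3)\<^sup>2 mod 3" by (simp add: power_mod)
    ultimately show ?thesis unfolding dvd_eq_mod_eq_0 by auto
  qed
  have "(a\<^sup>2 mod 3 + b\<^sup>2 mod 3) mod 3 = 0"
    using assms unfolding dvd_eq_mod_eq_0 mod_add_eq .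
  then show ?thesis by (simp add: sq split: if_splits)
qed

text \<open>The descent: a zero with \<open>x \<noteq> 0\<close> yields one with a smaller nonzero first coordinate.\<close>

lemma anisotropic_at_three:
  fixes x d t :: int
  assumes "3 * x\<^sup>2 + 2 * d\<^sup>2 = t\<^sup>2"
  shows "x = 0"
  using assms
proof (induction "nat \<bar>x\<bar>" arbitrary: x d t rule: less_induct)
  case less
  show ?case
  proof (rule ccontr)
    assume "x \<noteq> 0"
    have "t\<^sup>2 + d\<^sup>2 = 3 * (x\<^sup>2 + d\<^sup>2)"
      using less.prems by simp
    then have "3 dvd t\<^sup>2 + d\<^sup>2" by simp
    then obtain t' d' where td: "t = 3 * t'" "d = 3 * d'"
      using three_dvd_sum_two_squares by blast
    have "x\<^sup>2 = 3 * (t'\<^sup>2 - 2 * d'\<^sup>2)"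
      using less.prems by (simp add: td power_mult_distrib)
    then have "3 dvd x\<^sup>2 + 0\<^sup>2" by simp
    then obtain x' where x: "x = 3 * x'"
      using three_dvd_sum_two_squares by blast
    have "3 * x'\<^sup>2 + 2 * d'\<^sup>2 = t'\<^sup>2"
      using less.prems by (simp add: td x power_mult_distrib)
    moreover have "nat \<bar>x'\<bar> < nat \<bar>x\<bar>"
      using \<open>x \<noteq> 0\<close> x by simp
    ultimately have "x' = 0" by (rule less.hyps[rotated])
    with x \<open>x \<noteq> 0\<close> show False by simp
  qed
qed

theorem theorem1:
  shows "\<not> (\<exists>a1 a2 a3 :: int. a1 > 0 \<and> a2 > 0 \<and> a3 > 0 \<and>
           consecutive_in_AP a1 a2 a3 \<and> is_square (a1\<^sup>2 + a2\<^sup>2 + a3\<^sup>2))"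
proof
  assume "\<exists>a1 a2 a3 :: int. a1 > 0 \<and> a2 > 0 \<and> a3 > 0 \<and>
           consecutive_in_AP a1 a2 a3 \<and> is_square (a1\<^sup>2 + a2\<^sup>2 + a3\<^sup>2)"
  then obtain a1 a2 a3 d :: int
    where "a2 > 0" and "a2 = a1 + d" "a3 = a1 + 2 * d" and "is_square (a1\<^sup>2 + a2\<^sup>2 + a3\<^sup>2)"
    unfolding consecutive_in_AP_def by blast
  moreover from this obtain t where t: "a1\<^sup>2 + a2\<^sup>2 + a3\<^sup>2 = t\<^sup>2"
    by (elim is_nth_powerE)
  ultimately have "a1 = a2 - d" "a3 = a2 + d" by simp_all
  with t have "3 * a2\<^sup>2 + 2 * d\<^sup>2 = t\<^sup>2"
    by (simp add: power2_eq_square algebra_simps)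
  then have "a2 = 0" by (rule anisotropic_at_three)
  with \<open>a2 > 0\<close> show False by simp
qed

end
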